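(* Let $\mathbf a=\{a_k\}_{k=1}^n$ and $\mathbf b=\{b_k\}_{k=1}^n$ be non-negative non-increasing sequences. Then $$0\le \frac{\left(\sum_{k=1}^n (-1)^{k+1}a_k^p\right)^{1/p}+\left(\sum_{k=1}^n (-1)^{k+1} b_k^p\right)^{1/p}}{\left(\sum_{k=1}^n (-1)^{k+1}(a_k +b_k)^p\right)^{1/p}} \le 2^{1-1/p},\qquad p\ge 1.$$ The constant $2^{1-1/p}$ is best possible. The left-hand inequality should be read as follows: for all $n\ge 2$ there exists no positive constant depending on $p$ only and bounding the fraction from below. The fraction in the displayed inequality becomes reciprocal (that is, it is replaced by its reciprocal) if $0<p<1$.
   Context: Here $n$ is a positive integer or infinity, and the sequences consist of real numbers. Sequences for which a denominator in the inequality vanishes are excluded.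
   Formalization: For 0<p<1 the reciprocal fraction is bounded by 2^{1/p-1} (2^{1-1/p} fails for a=b=(1)); the absence of a positive lower bound is claimed only for p≠1, since at p=1 the fraction is always 1; the constant is shown best possible for each n≥3. *)

theory Defs
  imports Complex_Main "HOL-Library.Extended_Nat"
begin

text \<open>
  A sequence with index range \<open>k = 1, \<dots>, n\<close>, where \<open>n\<close> may be infinite, is a function on
  \<^typ>\<open>nat\<close> of which only the values at \<open>k\<close> with \<open>1 \<le> k\<close> and \<open>enat k \<le> n\<close> matter.
\<close>

definition nonneg_noninc :: "enat \<Rightarrow> (nat \<Rightarrow> real) \<Rightarrow> bool" where
  "nonneg_noninc n a \<longleftrightarrow>
     (\<forall>k. 1 \<le> k \<and> enat k \<le> n \<longrightarrow> 0 \<le> a k) \<and>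
     (\<forall>k. 1 \<le> k \<and> enat (Suc k) \<le> n \<longrightarrow> a (Suc k) \<le> a k)"

text \<open>
  For \<open>n = \<infinity>\<close> this is the limit of the partial sums in the natural order; the
  series need not converge absolutely, so an unordered sum would not do.
\<close>

definition alt_sum :: "enat \<Rightarrow> (nat \<Rightarrow> real) \<Rightarrow> real" where
  "alt_sum n x = (case n of
       enat m \<Rightarrow> (\<Sum>k=1..m. (-1) ^ (k + 1) * x k)
     | \<infinity> \<Rightarrow> (\<Sum>j. (-1) ^ (Suc j + 1) * x (Suc j)))"

definition alt_sum_converges :: "enat \<Rightarrow> (nat \<Rightarrow> real) \<Rightarrow> bool" where
  "alt_sum_converges n x \<longleftrightarrow>
     (n = \<infinity> \<longrightarrow> summable (\<lambda>j. (-1) ^ (Suc j + 1) * x (Suc j)))"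

definition alt_norm :: "enat \<Rightarrow> real \<Rightarrow> (nat \<Rightarrow> real) \<Rightarrow> real" where
  "alt_norm n p a = alt_sum n (\<lambda>k. a k powr p) powr (1 / p)"

text \<open>
  If \<open>n = \<infinity>\<close> and \<open>0 < p\<close>, convergence means that \<open>a\<close> tends to \<open>0\<close>; hence if \<open>a\<close> and \<open>b\<close> are
  admissible, so is their sum.
\<close>

definition admissible :: "enat \<Rightarrow> real \<Rightarrow> (nat \<Rightarrow> real) \<Rightarrow> bool" where
  "admissible n p a \<longleftrightarrow> nonneg_noninc n a \<and> alt_sum_converges n (\<lambda>k. a k powr p)"

end

theory Submission
  imports Defs
begin

text \<open>
  For \<open>p \<ge> 1\<close> the map \<open>(x, y) \<mapsto> (x + y)\<^sup>p - x\<^sup>p - y\<^sup>p\<close> is non-decreasing in each variable on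
  the quadrant, so along two non-increasing sequences it gives a non-increasing sequence, whose
  alternating sum is non-negative. Hence the alternating sum of \<open>(a + b)\<^sup>p\<close> dominates the sum of
  those of \<open>a\<^sup>p\<close> and \<open>b\<^sup>p\<close>, and the power mean inequality gives the factor \<open>2\<^bsup>1 - 1/p\<^esup>\<close>. For
  \<open>p \<le> 1\<close> all inequalities are reversed. The constant is approached by \<open>a = (1, 1, 1)\<close> and
  \<open>b = ((t + 1)\<^bsup>1/p\<^esup>, t\<^bsup>1/p\<^esup>, 0)\<close> as \<open>t\<close> tends to infinity, and the pair \<open>a = (1, 1)\<close>,
  \<open>b = (e, 0)\<close> with small \<open>e\<close> rules out a positive lower bound.
\<close>

section \<open>Increments of powers\<close>

text \<open>The derivative in t is p ((t + b)^(p-1) - t^(p-1)), non-negative because p - 1 >= 0. The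
  criterion asks for derivatives in the open interval and continuity on the closed one, since
  \<open>x\<close> may be 0 and the power rule for \<open>powr\<close> wants a positive
  base.\<close>

lemma powr_add_diff_mono:
  fixes p :: real
  assumes "1 \<le> p" "0 \<le> x" "x \<le> y" "0 \<le> b"
  shows "(x + b) powr p - x powr p \<le> (y + b) powr p - y powr p"
proof (rule DERIV_nonneg_imp_increasing_open[of x y "\<lambda>t. (t + b) powr p - t powr p"])
  fix t assume t: "x < t" "t < y"
  have "((\<lambda>t. (t + b) powr p - t powr p) has_real_derivative
          p * (t + b) powr (p - 1) - p * t powr (p - 1)) (at t)"
    using t assms by (auto intro!: derivative_eq_intros)
  moreover have "t powr (p - 1) \<le> (t + b) powr (p - 1)"
    using t assms by (intro powr_mono2) auto
  ultimately show "\<exists>d. ((\<lambda>t. (t + b) powr p - t powr p) has_real_derivative d) (at t) \<and> 0 \<le> d"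
    using assms by (intro exI[of _ "p * (t + b) powr (p - 1) - p * t powr (p - 1)"]) (auto simp: mult_left_mono)
qed (use assms in \<open>auto intro!: continuous_intros continuous_on_powr'\<close>)

text \<open>The exponent p - 1 is non-positive here, so the sign of the derivative flips.\<close>

lemma powr_add_diff_antimono:
  fixes p :: real
  assumes "0 < p" "p \<le> 1" "0 \<le> x" "x \<le> y" "0 \<le> b"
  shows "(y + b) powr p - y powr p \<le> (x + b) powr p - x powr p"
proof (rule DERIV_nonpos_imp_decreasing_open[of x y "\<lambda>t. (t + b) powr p - t powr p"])
  fix t assume t: "x < t" "t < y"
  have "((\<lambda>t. (t + b) powr p - t powr p) has_real_derivative
          p * (t + b) powr (p - 1) - p * t powr (p - 1)) (at t)"
    using t assms by (auto intro!: derivative_eq_intros)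
  moreover have "(t + b) powr (p - 1) \<le> t powr (p - 1)"
    using t assms by (intro powr_mono2') auto
  ultimately show "\<exists>d. ((\<lambda>t. (t + b) powr p - t powr p) has_real_derivative d) (at t) \<and> d \<le> 0"
    using assms by (intro exI[of _ "p * (t + b) powr (p - 1) - p * t powr (p - 1)"]) (auto simp: mult_left_mono)
qed (use assms in \<open>auto intro!: continuous_intros continuous_on_powr'\<close>)

text \<open>Move one variable at a time, from (x, y) to (x', y) to (x', y'); each move is an
  instance of the one-variable lemma.\<close>

lemma powr_super_add_diff_mono:
  fixes p :: real
  assumes "1 \<le> p" "0 \<le> x" "x \<le> x'" "0 \<le> y" "y \<le> y'"
  shows "(x + y) powr p - x powr p - y powr p \<le> (x' + y') powr p - x' powr p - y' powr p"
  using powr_add_diff_mono[of p x x' y] powr_add_diff_mono[of p y y' x'] assms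
  by (simp add: add.commute)

lemma powr_sub_add_diff_antimono:
  fixes p :: real
  assumes "0 < p" "p \<le> 1" "0 \<le> x" "x \<le> x'" "0 \<le> y" "y \<le> y'"
  shows "x powr p + y powr p - (x + y) powr p \<le> x' powr p + y' powr p - (x' + y') powr p"
  using powr_add_diff_antimono[of p x x' y] powr_add_diff_antimono[of p y y' x'] assms
  by (simp add: add.commute)

text \<open>This is midpoint convexity of t^r, rescaled. For v <= u the midpoint is at distance h =
  (u - v)/2 from both, and the increment of t^r over a step h is larger from the midpoint to u than
  from v to the midpoint.\<close>

lemma powr_add_le_two_powr:
  fixes r :: real
  assumes "1 \<le> r" "0 \<le> u" "0 \<le> v"
  shows "(u + v) powr r \<le> 2 powr (r - 1) * (u powr r + v powr r)"
proof -
  have *: "2 * ((u + v) / 2) powr r \<le> u powr r + v powr r" if "v \<le> u" "0 \<le> v" for u v :: real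
  proof -
    have eqs: "(u + v) / 2 + (u - v) / 2 = u" "v + (u - v) / 2 = (u + v) / 2"
      by (auto simp: field_simps)
    show ?thesis
      using powr_add_diff_mono[of r v "(u + v) / 2" "(u - v) / 2"] that assms(1)
      unfolding eqs by simp
  qed
  have "2 * ((u + v) / 2) powr r \<le> u powr r + v powr r"
    using *[of v u] *[of u v] assms by (cases "v \<le> u") (simp_all add: add.commute)
  then show ?thesis
    using assms by (simp add: powr_divide powr_diff field_simps)
qed

section \<open>Alternating sums: sign and linearity\<close>

text \<open>The first two terms contribute f 0 - f 1 >= 0, and what remains is an alternating sum of
  the same kind, shorter by two and starting with the same sign.\<close>

lemma alternating_sum_nonneg:
  fixes f :: "nat \<Rightarrow> real"
  assumes "\<And>j. j < m \<Longrightarrow> 0 \<le> f j" "\<And>j. Suc j < m \<Longrightarrow> f (Suc j) \<le> f j"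
  shows "0 \<le> (\<Sum>j<m. (-1) ^ j * f j)"
  using assms
proof (induction m arbitrary: f rule: less_induct)
  case (less m)
  consider "m = 0" | "m = 1" | l where "m = Suc (Suc l)"
    by (cases m; cases "m - 1") auto
  then show ?case
  proof cases
    case 3
    have "0 \<le> (\<Sum>j<l. (-1) ^ j * f (Suc (Suc j)))"
      using less.IH[of l "\<lambda>j. f (Suc (Suc j))"] less.prems 3 by auto
    moreover have "f 1 \<le> f 0"
      using less.prems(2)[of 0] 3 by simp
    ultimately show ?thesis
      by (simp add: 3 sum.lessThan_Suc_shift del: sum.lessThan_Suc)
  qed (use less.prems(1)[of 0] in auto)
qed

text \<open>For k = j + 1 the sign is (-1)^(j+2) = (-1)^j. This zero-based form is shared by finite
  sums and series.\<close>

lemma sum_from_1_eq: "(\<Sum>k=1..m. (-1) ^ (k + 1) * x k) = (\<Sum>j<m. (-1) ^ j * (x (Suc j) :: real))"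
  by (simp add: sum.atLeast1_atMost_eq)

lemma alt_sum_enat: "alt_sum (enat m) x = (\<Sum>j<m. (-1) ^ j * x (Suc j))"
  using sum_from_1_eq[of x m] by (simp add: alt_sum_def)

lemma alt_sum_infinity: "alt_sum \<infinity> x = (\<Sum>j. (-1) ^ j * x (Suc j))"
  by (simp add: alt_sum_def)

lemma alt_sum_converges_infinity:
  "alt_sum_converges \<infinity> x \<longleftrightarrow> summable (\<lambda>j. (-1) ^ j * x (Suc j))"
  by (simp add: alt_sum_converges_def)

lemma alt_sum_converges_enat: "alt_sum_converges (enat m) x"
  by (simp add: alt_sum_converges_def)

text \<open>For infinite \<open>n\<close> a series may be split only if both parts converge.
  Convergence of the result is recorded as well, because \<open>alt_sum_nonneg\<close> asks for
  it.\<close>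

lemma alt_sum_diff:
  assumes "alt_sum_converges n x" "alt_sum_converges n y"
  shows "alt_sum n (\<lambda>k. x k - y k) = alt_sum n x - alt_sum n y"
    and "alt_sum_converges n (\<lambda>k. x k - y k)"
  using assms
  by (cases n; simp add: alt_sum_enat alt_sum_infinity alt_sum_converges_infinity
      alt_sum_converges_enat right_diff_distrib sum_subtractf suminf_diff summable_diff)+

lemma alt_sum_add:
  assumes "alt_sum_converges n x" "alt_sum_converges n y"
  shows "alt_sum n (\<lambda>k. x k + y k) = alt_sum n x + alt_sum n y"
    and "alt_sum_converges n (\<lambda>k. x k + y k)"
  using assms
  by (cases n; simp add: alt_sum_enat alt_sum_infinity alt_sum_converges_infinity
      alt_sum_converges_enat distrib_left sum.distrib suminf_add summable_add)+

text \<open>For a series, every partial sum is non-negative and the bound passes to the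
  limit.\<close>

lemma alt_sum_nonneg:
  assumes "nonneg_noninc n x" "alt_sum_converges n x"
  shows "0 \<le> alt_sum n x"
proof (cases n)
  case (enat m)
  then show ?thesis
    using assms(1) by (auto simp: alt_sum_enat nonneg_noninc_def intro!: alternating_sum_nonneg)
next
  case infinity
  have "0 \<le> (\<Sum>j<m. (-1) ^ j * x (Suc j))" for m
    using assms(1) infinity by (auto simp: nonneg_noninc_def intro!: alternating_sum_nonneg)
  moreover have "(\<lambda>m. \<Sum>j<m. (-1) ^ j * x (Suc j)) \<longlonglongrightarrow> alt_sum n x"
    using assms(2) infinity
    by (simp add: alt_sum_infinity alt_sum_converges_infinity summable_LIMSEQ)
  ultimately show ?thesis
    by (intro LIMSEQ_le_const) auto
qed

section \<open>Admissible sequences and their sums\<close>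

lemma nonneg_noninc_powr:
  assumes "nonneg_noninc n a" "0 < p"
  shows "nonneg_noninc n (\<lambda>k. a k powr p)"
proof -
  have "0 \<le> a (Suc k)" if "enat (Suc k) \<le> n" for k
    using assms(1) that by (auto simp: nonneg_noninc_def)
  then show ?thesis
    using assms by (auto simp: nonneg_noninc_def intro!: powr_mono2)
qed

lemma alt_sum_powr_nonneg: "0 < p \<Longrightarrow> admissible n p a \<Longrightarrow> 0 \<le> alt_sum n (\<lambda>k. a k powr p)"
  by (auto simp: admissible_def intro!: alt_sum_nonneg nonneg_noninc_powr)

text \<open>The terms of a convergent series tend to 0; absolute values remove the sign, and the
  1/p-th power recovers \<open>a\<close> itself.\<close>

lemma admissible_infinity_tendsto_0:
  assumes "0 < p" "admissible \<infinity> p a"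
  shows "(\<lambda>j. a (Suc j)) \<longlonglongrightarrow> 0"
proof -
  have "(\<lambda>j. (-1) ^ j * a (Suc j) powr p) \<longlonglongrightarrow> 0"
    using assms by (simp add: admissible_def alt_sum_converges_infinity summable_LIMSEQ_zero)
  then have "(\<lambda>j. a (Suc j) powr p) \<longlonglongrightarrow> 0"
    by (subst (asm) tendsto_rabs_zero_iff[symmetric]) (simp add: abs_mult power_abs)
  then have "(\<lambda>j. (a (Suc j) powr p) powr (1 / p)) \<longlonglongrightarrow> 0 powr (1 / p)"
    using assms(1) by (intro tendsto_powr') (auto simp: powr_ge_zero)
  moreover have "(a (Suc j) powr p) powr (1 / p) = a (Suc j)" for j
    using assms by (simp add: powr_powr admissible_def nonneg_noninc_def)
  ultimately show ?thesis by simp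
qed

text \<open>For infinite \<open>n\<close> the two given series say nothing termwise about the powers
  of the sum. But both sequences tend to 0, hence so does (a + b)^p, which is also non-increasing,
  and the Leibniz criterion applies.\<close>

lemma admissible_add:
  assumes p: "0 < p" and a: "admissible n p a" and b: "admissible n p b"
  shows "admissible n p (\<lambda>k. a k + b k)"
proof -
  have nn: "nonneg_noninc n (\<lambda>k. a k + b k)"
    using a b by (auto simp: admissible_def nonneg_noninc_def intro: add_mono)
  have "alt_sum_converges n (\<lambda>k. (a k + b k) powr p)"
  proof (cases n)
    case infinity
    have "(\<lambda>j. a (Suc j) + b (Suc j)) \<longlonglongrightarrow> 0 + 0"
      using p a b infinity by (intro tendsto_add admissible_infinity_tendsto_0) auto
    then have "(\<lambda>j. (a (Suc j) + b (Suc j)) powr p) \<longlonglongrightarrow> 0 powr p"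
      using p nn infinity by (intro tendsto_powr') (auto simp: nonneg_noninc_def)
    moreover have "nonneg_noninc n (\<lambda>k. (a k + b k) powr p)"
      using nn p by (rule nonneg_noninc_powr)
    ultimately show ?thesis
      using infinity by (auto simp: alt_sum_converges_infinity nonneg_noninc_def
          intro!: summable_Leibniz')
  qed (simp add: alt_sum_converges_enat)
  with nn show ?thesis by (simp add: admissible_def)
qed

section \<open>The upper bounds\<close>

lemma alt_sum_powr_add_ge:
  assumes "1 \<le> p" "admissible n p a" "admissible n p b"
  shows "alt_sum n (\<lambda>k. a k powr p) + alt_sum n (\<lambda>k. b k powr p)
           \<le> alt_sum n (\<lambda>k. (a k + b k) powr p)"
proof -
  let ?f = "\<lambda>k. (a k + b k) powr p - (a k powr p + b k powr p)"
  \<comment> \<open>Convergence of all three series allows the alternating sum of the defect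
    \<open>?f\<close> to be split.\<close>
  have conv: "alt_sum_converges n (\<lambda>k. (a k + b k) powr p)"
    "alt_sum_converges n (\<lambda>k. a k powr p)" "alt_sum_converges n (\<lambda>k. b k powr p)"
    using admissible_add[of p n a b] assms by (auto simp: admissible_def)
  have nn: "0 \<le> a k" "0 \<le> b k" if "1 \<le> k" "enat k \<le> n" for k
    using assms that by (auto simp: admissible_def nonneg_noninc_def)
  have "nonneg_noninc n ?f"
    unfolding nonneg_noninc_def
  proof (intro conjI allI impI)
    fix k assume k: "1 \<le> k \<and> enat k \<le> n"
    \<comment> \<open>The defect vanishes at (0, 0), so its monotonicity already gives its
      sign.\<close>
    show "0 \<le> ?f k"
      using powr_super_add_diff_mono[of p 0 "a k" 0 "b k"] nn[of k] k assms(1) by simp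
  next
    fix k assume k: "1 \<le> k \<and> enat (Suc k) \<le> n"
    then have "a (Suc k) \<le> a k" "b (Suc k) \<le> b k"
      using assms by (auto simp: admissible_def nonneg_noninc_def)
    then show "?f (Suc k) \<le> ?f k"
      using powr_super_add_diff_mono[of p "a (Suc k)" "a k" "b (Suc k)" "b k"] nn[of "Suc k"] k
        assms(1) by simp
  qed
  then have "0 \<le> alt_sum n ?f"
    using conv by (intro alt_sum_nonneg alt_sum_diff alt_sum_add)
  then show ?thesis
    using conv by (simp add: alt_sum_diff alt_sum_add)
qed

text \<open>Powers with p <= 1 are subadditive, so the defect is taken with the opposite sign to be
  non-negative and non-increasing.\<close>

lemma alt_sum_powr_add_le:
  assumes "0 < p" "p \<le> 1" "admissible n p a" "admissible n p b"
  shows "alt_sum n (\<lambda>k. (a k + b k) powr p)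
           \<le> alt_sum n (\<lambda>k. a k powr p) + alt_sum n (\<lambda>k. b k powr p)"
proof -
  let ?f = "\<lambda>k. (a k powr p + b k powr p) - (a k + b k) powr p"
  have conv: "alt_sum_converges n (\<lambda>k. (a k + b k) powr p)"
    "alt_sum_converges n (\<lambda>k. a k powr p)" "alt_sum_converges n (\<lambda>k. b k powr p)"
    using admissible_add[of p n a b] assms by (auto simp: admissible_def)
  have nn: "0 \<le> a k" "0 \<le> b k" if "1 \<le> k" "enat k \<le> n" for k
    using assms that by (auto simp: admissible_def nonneg_noninc_def)
  have "nonneg_noninc n ?f"
    unfolding nonneg_noninc_def
  proof (intro conjI allI impI)
    fix k assume k: "1 \<le> k \<and> enat k \<le> n"
    show "0 \<le> ?f k"
      using powr_sub_add_diff_antimono[of p 0 "a k" 0 "b k"] nn[of k] k assms(1,2) by simp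
  next
    fix k assume k: "1 \<le> k \<and> enat (Suc k) \<le> n"
    then have "a (Suc k) \<le> a k" "b (Suc k) \<le> b k"
      using assms by (auto simp: admissible_def nonneg_noninc_def)
    then show "?f (Suc k) \<le> ?f k"
      using powr_sub_add_diff_antimono[of p "a (Suc k)" "a k" "b (Suc k)" "b k"] nn[of "Suc k"] k
        assms(1,2) by simp
  qed
  then have "0 \<le> alt_sum n ?f"
    using conv by (intro alt_sum_nonneg alt_sum_diff alt_sum_add)
  then show ?thesis
    using conv by (simp add: alt_sum_diff alt_sum_add)
qed

lemma alt_norm_nonneg: "0 \<le> alt_norm n p a"
  by (simp add: alt_norm_def)

text \<open>The power mean inequality is applied to the two norms, whose p-th powers are
  \<open>?A\<close> and \<open>?B\<close>; superadditivity then brings in \<open>?S\<close>. The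
  p-th root turns the factor 2^(p-1) into 2^(1-1/p).\<close>

lemma alt_norm_add_ge:
  assumes "1 \<le> p" "admissible n p a" "admissible n p b"
  shows "alt_norm n p a + alt_norm n p b \<le> 2 powr (1 - 1 / p) * alt_norm n p (\<lambda>k. a k + b k)"
proof -
  let ?A = "alt_sum n (\<lambda>k. a k powr p)" and ?B = "alt_sum n (\<lambda>k. b k powr p)"
  let ?S = "alt_sum n (\<lambda>k. (a k + b k) powr p)"
  have nn: "0 \<le> ?A" "0 \<le> ?B"
    using assms by (auto intro: alt_sum_powr_nonneg)
  have "(alt_norm n p a + alt_norm n p b) powr p \<le> 2 powr (p - 1) * (?A + ?B)"
    using powr_add_le_two_powr[of p "alt_norm n p a" "alt_norm n p b"] assms(1) nn
    by (simp add: alt_norm_def powr_powr)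
  also have "\<dots> \<le> 2 powr (p - 1) * ?S"
    using alt_sum_powr_add_ge[OF assms] by simp
  finally have "((alt_norm n p a + alt_norm n p b) powr p) powr (1 / p)
      \<le> (2 powr (p - 1) * ?S) powr (1 / p)"
    using assms(1) by (intro powr_mono2) auto
  moreover have "(p - 1) * (1 / p) = 1 - 1 / p"
    using assms(1) by (simp add: field_simps)
  ultimately show ?thesis
    using assms(1) nn alt_sum_powr_add_ge[OF assms] alt_norm_nonneg[of n p]
    by (simp add: alt_norm_def powr_powr powr_mult)
qed

text \<open>Here 1/p >= 1, so the order is reversed: first subadditivity of the alternating sums,
  then the power mean inequality with exponent 1/p applied to \<open>?A\<close> and
  \<open>?B\<close> themselves.\<close>

lemma alt_norm_add_le:
  assumes "0 < p" "p \<le> 1" "admissible n p a" "admissible n p b"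
  shows "alt_norm n p (\<lambda>k. a k + b k) \<le> 2 powr (1 / p - 1) * (alt_norm n p a + alt_norm n p b)"
proof -
  let ?A = "alt_sum n (\<lambda>k. a k powr p)" and ?B = "alt_sum n (\<lambda>k. b k powr p)"
  have nn: "0 \<le> ?A" "0 \<le> ?B" "0 \<le> alt_sum n (\<lambda>k. (a k + b k) powr p)"
    using assms by (auto intro: alt_sum_powr_nonneg admissible_add)
  have "alt_norm n p (\<lambda>k. a k + b k) \<le> (?A + ?B) powr (1 / p)"
    unfolding alt_norm_def using alt_sum_powr_add_le[OF assms] nn assms by (intro powr_mono2) auto
  also have "\<dots> \<le> 2 powr (1 / p - 1) * (alt_norm n p a + alt_norm n p b)"
    unfolding alt_norm_def using powr_add_le_two_powr[of "1 / p" ?A ?B] nn assms by simp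
  finally show ?thesis .
qed

section \<open>Sequences with at most three nonzero terms\<close>

text \<open>This lets one example padded with zeros serve every sufficiently large \<open>n\<close>,
  including infinity.\<close>

lemma alt_sum_finite_support:
  assumes "enat m \<le> n" "\<And>k. m < k \<Longrightarrow> x k = 0"
  shows "alt_sum n x = (\<Sum>j<m. (-1) ^ j * x (Suc j))" "alt_sum_converges n x"
proof -
  have "alt_sum n x = (\<Sum>j<m. (-1) ^ j * x (Suc j)) \<and> alt_sum_converges n x"
  proof (cases n)
    case (enat l)
    moreover have "j < m" if "x (Suc j) \<noteq> 0" for j
      using assms(2)[of "Suc j"] that by fastforce
    ultimately show ?thesis
      using assms(1)
      by (auto simp: alt_sum_enat alt_sum_converges_enat intro!: sum.mono_neutral_right)
  next
    case infinity
    have "(\<lambda>j. (-1) ^ j * x (Suc j)) sums (\<Sum>j<m. (-1) ^ j * x (Suc j))"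
      using assms(2) by (intro sums_finite) auto
    then show ?thesis
      using infinity
      by (auto simp: alt_sum_infinity alt_sum_converges_infinity sums_iff)
  qed
  then show "alt_sum n x = (\<Sum>j<m. (-1) ^ j * x (Suc j))" "alt_sum_converges n x"
    by auto
qed

definition seq3 :: "real \<Rightarrow> real \<Rightarrow> real \<Rightarrow> nat \<Rightarrow> real" where
  "seq3 x y z k = (if k = 1 then x else if k = 2 then y else if k = 3 then z else 0)"

lemma seq3_add: "(\<lambda>k. seq3 x y z k + seq3 x' y' z' k) = seq3 (x + x') (y + y') (z + z')"
  by (auto simp: seq3_def fun_eq_iff)

lemma seq3_powr: "(\<lambda>k. seq3 x y z k powr p) = seq3 (x powr p) (y powr p) (z powr p)"
  by (auto simp: seq3_def fun_eq_iff)

text \<open>For n = 2 the third entry lies outside the index range, whence the alternative z =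
  0.\<close>

lemma alt_sum_seq3:
  assumes "3 \<le> n \<or> (z = 0 \<and> 2 \<le> n)"
  shows "alt_sum n (seq3 x y z) = x - y + z" "alt_sum_converges n (seq3 x y z)"
proof -
  have "alt_sum n (seq3 x y z) = x - y + z \<and> alt_sum_converges n (seq3 x y z)"
    using assms
  proof
    assume "3 \<le> n"
    then have "enat 3 \<le> n" by (simp add: numeral_eq_enat)
    then show ?thesis
      using alt_sum_finite_support[of 3 n "seq3 x y z"]
      by (simp add: seq3_def numeral_eq_Suc)
  next
    assume *: "z = 0 \<and> 2 \<le> n"
    then have "enat 2 \<le> n" by (simp add: numeral_eq_enat)
    then show ?thesis
      using * alt_sum_finite_support[of 2 n "seq3 x y z"]
      by (simp add: seq3_def numeral_eq_Suc)
  qed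
  then show "alt_sum n (seq3 x y z) = x - y + z" "alt_sum_converges n (seq3 x y z)"
    by auto
qed

lemma alt_norm_seq3:
  assumes "3 \<le> n \<or> (z = 0 \<and> 2 \<le> n)"
  shows "alt_norm n p (seq3 x y z) = (x powr p - y powr p + z powr p) powr (1 / p)"
  using assms by (simp add: alt_norm_def seq3_powr alt_sum_seq3)

lemma admissible_seq3:
  assumes "3 \<le> n \<or> (z = 0 \<and> 2 \<le> n)" "0 \<le> z" "z \<le> y" "y \<le> x"
  shows "admissible n p (seq3 x y z)"
  using assms alt_sum_seq3(2)[of n "z powr p" "x powr p" "y powr p"]
  by (auto simp: admissible_def nonneg_noninc_def seq3_powr) (auto simp: seq3_def)

section \<open>Extremal and degenerate examples\<close>

text \<open>With q = 1/p, the function g(t) = (1 + t^q)^p has derivative (1 + t^(-q))^(p-1), which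
  tends to 1 at infinity. By the mean value theorem its unit increments do too. They start at t = 1,
  where g is differentiable.\<close>

lemma one_plus_powr_increment_tendsto_1:
  fixes p :: real
  assumes p: "0 < p"
  shows "(\<lambda>m. (1 + (real m + 2) powr (1 / p)) powr p - (1 + (real m + 1) powr (1 / p)) powr p)
           \<longlonglongrightarrow> 1"
proof -
  define q where "q = 1 / p"
  let ?g = "\<lambda>t::real. (1 + t powr q) powr p"
  have q: "0 < q" "p * q = 1" using p by (auto simp: q_def)
  have deriv: "(?g has_real_derivative (1 + t powr (- q)) powr (p - 1)) (at t)" if "0 < t" for t
  proof -
    have "(?g has_real_derivative p * (1 + t powr q) powr (p - 1) * (q * t powr (q - 1))) (at t)"
      using that by (auto intro!: derivative_eq_intros simp: add_pos_nonneg)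
    moreover have "p * (1 + t powr q) powr (p - 1) * (q * t powr (q - 1))
        = (1 + t powr (- q)) powr (p - 1)"
    proof -
      \<comment> \<open>Pulling t^q out of the base gives the factor t^(q(p-1)) = t^(1-q), which
        cancels t^(q-1); the constants cancel as p q = 1.\<close>
      have "1 + t powr q = t powr q * (1 + t powr (- q))"
        using that by (simp add: distrib_left flip: powr_add)
      then have "(1 + t powr q) powr (p - 1) = t powr (q * (p - 1)) * (1 + t powr (- q)) powr (p - 1)"
        by (simp add: powr_mult powr_powr)
      also have "q * (p - 1) = 1 - q"
        using q(2) by (simp add: algebra_simps)
      finally have "p * (1 + t powr q) powr (p - 1) * (q * t powr (q - 1))
          = (p * q) * (t powr (1 - q) * t powr (q - 1)) * (1 + t powr (- q)) powr (p - 1)"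
        by simp
      also have "t powr (1 - q) * t powr (q - 1) = 1"
        using that by (simp flip: powr_add)
      finally show ?thesis using q(2) by simp
    qed
    ultimately show ?thesis by simp
  qed
  have "\<exists>z. real m < z \<and> ?g (real m + 2) - ?g (real m + 1) = (1 + z powr (- q)) powr (p - 1)" for m
  proof -
    have "\<exists>z>real m + 1. z < real m + 2 \<and> ?g (real m + 2) - ?g (real m + 1)
        = (real m + 2 - (real m + 1)) * (1 + z powr (- q)) powr (p - 1)"
      by (rule MVT2) (use deriv in auto)
    then show ?thesis
      by (metis add_diff_cancel_left' add_lessD1 diff_add_cancel less_add_one less_trans
          mult_1 one_add_one add.assoc)
  qed
  then obtain z where z: "\<And>m. real m < z m"
    "\<And>m. ?g (real m + 2) - ?g (real m + 1) = (1 + z m powr (- q)) powr (p - 1)"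
    by metis
  \<comment> \<open>The intermediate points lie beyond \<open>m\<close>, hence escape to
    infinity.\<close>
  have "filterlim z at_top sequentially"
    by (rule filterlim_at_top_mono[OF filterlim_real_sequentially])
      (simp add: less_imp_le z(1))
  then have "(\<lambda>m. z m powr (- q)) \<longlonglongrightarrow> 0"
    using q(1) by (intro tendsto_neg_powr) auto
  then have "(\<lambda>m. (1 + z m powr (- q)) powr (p - 1)) \<longlonglongrightarrow> (1 + 0) powr (p - 1)"
    by (intro tendsto_intros) auto
  then show ?thesis
    by (simp add: z(2)[symmetric] flip: q_def)
qed

text \<open>Both alternating sums of p-th powers equal 1, which is the equality case of the power
  mean inequality. The alternating sum for a + b is \<open>?d m\<close> + 1 and tends to 2 = 1 + 1,
  so superadditivity (subadditivity for p <= 1) becomes an equality in the limit.\<close>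

lemma extremal_family:
  fixes p :: real
  assumes p: "0 < p" and n: "3 \<le> n"
  obtains a b where "\<And>m::nat. admissible n p (a m)" "\<And>m. admissible n p (b m)"
    "\<And>m. alt_norm n p (a m) = 1" "\<And>m. alt_norm n p (b m) = 1"
    "\<And>m. alt_norm n p (\<lambda>k. a m k + b m k) > 0"
    "(\<lambda>m. alt_norm n p (\<lambda>k. a m k + b m k)) \<longlonglongrightarrow> 2 powr (1 / p)"
proof -
  let ?a = "\<lambda>m::nat. seq3 1 1 1"
  let ?b = "\<lambda>m. seq3 ((real m + 2) powr (1 / p)) ((real m + 1) powr (1 / p)) 0"
  let ?d = "\<lambda>m. (1 + (real m + 2) powr (1 / p)) powr p - (1 + (real m + 1) powr (1 / p)) powr p"
  have mono: "(real m + 1) powr (1 / p) \<le> (real m + 2) powr (1 / p)" for m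
    using p by (intro powr_mono2) auto
  have S: "alt_norm n p (\<lambda>k. ?a m k + ?b m k) = (?d m + 1) powr (1 / p)" for m
    using n by (simp add: seq3_add alt_norm_seq3)
  have d: "0 \<le> ?d m" for m
    using mono[of m] p by (simp add: powr_mono2 add_nonneg_nonneg)
  show thesis
  proof
    show "admissible n p (?a m)" "admissible n p (?b m)" for m
      using n mono by (auto intro!: admissible_seq3)
    show "alt_norm n p (?a m) = 1" "alt_norm n p (?b m) = 1" for m
      using n p by (simp_all add: alt_norm_seq3 powr_powr)
    show "alt_norm n p (\<lambda>k. ?a m k + ?b m k) > 0" for m
      using d[of m] unfolding S by simp
    have "(\<lambda>m. (?d m + 1) powr (1 / p)) \<longlonglongrightarrow> (1 + 1) powr (1 / p)"
      using p by (intro tendsto_intros one_plus_powr_increment_tendsto_1) auto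
    then show "(\<lambda>m. alt_norm n p (\<lambda>k. ?a m k + ?b m k)) \<longlonglongrightarrow> 2 powr (1 / p)"
      unfolding S by simp
  qed
qed

text \<open>The two equal entries of (1, 1, 0) cancel and give norm 0. Adding e to the first entry
  alone destroys the cancellation: the norm of the sum is of order e^(1/p) for small e, against e
  for the sum of the norms. The third entries are 0, so n = 2 is covered.\<close>

lemma degenerate_family:
  fixes p e :: real
  assumes p: "0 < p" and n: "2 \<le> n" and e: "0 < e"
  obtains a b where "admissible n p a" "admissible n p b"
    "alt_norm n p a = 0" "alt_norm n p b = e"
    "alt_norm n p (\<lambda>k. a k + b k) = ((1 + e) powr p - 1) powr (1 / p)"
proof
  show "admissible n p (seq3 1 1 0)" "admissible n p (seq3 e 0 0)"
    using n e by (auto intro!: admissible_seq3)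
  show "alt_norm n p (seq3 1 1 0) = 0" "alt_norm n p (seq3 e 0 0) = e"
    using n e p by (simp_all add: alt_norm_seq3 powr_powr)
  show "alt_norm n p (\<lambda>k. seq3 1 1 0 k + seq3 e 0 0 k) = ((1 + e) powr p - 1) powr (1 / p)"
    using n by (simp add: seq3_add alt_norm_seq3)
qed

section \<open>The inequalities and their sharpness\<close>

lemma small_powr_exists:
  fixes c s :: real
  assumes "0 < c" "0 < s"
  obtains e where "0 < e" "e powr s < c"
proof
  show "0 < (c / 2) powr (1 / s)" "((c / 2) powr (1 / s)) powr s < c"
    using assms by (auto simp: powr_powr)
qed

text \<open>Optimality is claimed from n = 3 on: for n = 1 the fraction is 1, and for n = 2
  Bellman's inequality (reversed for p < 1) gives the bound 1. The absence of a lower bound is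
  claimed for p different from 1, since at p = 1 the alternating sum is additive and the fraction is
  identically 1.\<close>

theorem theorem2:
  fixes p :: real
  shows
   "(1 \<le> p \<longrightarrow>
      (\<forall>(n::enat) a b. 1 \<le> n \<longrightarrow> admissible n p a \<longrightarrow> admissible n p b \<longrightarrow>
         alt_norm n p (\<lambda>k. a k + b k) \<noteq> 0 \<longrightarrow>
         0 \<le> (alt_norm n p a + alt_norm n p b) / alt_norm n p (\<lambda>k. a k + b k) \<and>
         (alt_norm n p a + alt_norm n p b) / alt_norm n p (\<lambda>k. a k + b k) \<le> 2 powr (1 - 1 / p)) \<and>
      (\<forall>(n::enat) C. 3 \<le> n \<longrightarrow>
         (\<forall>a b. admissible n p a \<longrightarrow> admissible n p b \<longrightarrow>
            alt_norm n p (\<lambda>k. a k + b k) \<noteq> 0 \<longrightarrow>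
            (alt_norm n p a + alt_norm n p b) / alt_norm n p (\<lambda>k. a k + b k) \<le> C) \<longrightarrow>
         2 powr (1 - 1 / p) \<le> C)) \<and>
    (1 < p \<longrightarrow>
      (\<forall>n::enat. 2 \<le> n \<longrightarrow>
         \<not> (\<exists>c>0. \<forall>a b. admissible n p a \<longrightarrow> admissible n p b \<longrightarrow>
            alt_norm n p (\<lambda>k. a k + b k) \<noteq> 0 \<longrightarrow>
            c \<le> (alt_norm n p a + alt_norm n p b) / alt_norm n p (\<lambda>k. a k + b k)))) \<and>
    (0 < p \<and> p < 1 \<longrightarrow>
      (\<forall>(n::enat) a b. 1 \<le> n \<longrightarrow> admissible n p a \<longrightarrow> admissible n p b \<longrightarrow>
         alt_norm n p a + alt_norm n p b \<noteq> 0 \<longrightarrow>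
         0 \<le> alt_norm n p (\<lambda>k. a k + b k) / (alt_norm n p a + alt_norm n p b) \<and>
         alt_norm n p (\<lambda>k. a k + b k) / (alt_norm n p a + alt_norm n p b) \<le> 2 powr (1 / p - 1)) \<and>
      (\<forall>(n::enat) C. 3 \<le> n \<longrightarrow>
         (\<forall>a b. admissible n p a \<longrightarrow> admissible n p b \<longrightarrow>
            alt_norm n p a + alt_norm n p b \<noteq> 0 \<longrightarrow>
            alt_norm n p (\<lambda>k. a k + b k) / (alt_norm n p a + alt_norm n p b) \<le> C) \<longrightarrow>
         2 powr (1 / p - 1) \<le> C) \<and>
      (\<forall>n::enat. 2 \<le> n \<longrightarrow>
         \<not> (\<exists>c>0. \<forall>a b. admissible n p a \<longrightarrow> admissible n p b \<longrightarrow>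
            alt_norm n p a + alt_norm n p b \<noteq> 0 \<longrightarrow>
            c \<le> alt_norm n p (\<lambda>k. a k + b k) / (alt_norm n p a + alt_norm n p b))))"
proof (intro conjI impI allI notI; (elim conjE exE)?)
  fix n :: enat and a b
  assume *: "1 \<le> p" "admissible n p a" "admissible n p b" "alt_norm n p (\<lambda>k. a k + b k) \<noteq> 0"
  show "0 \<le> (alt_norm n p a + alt_norm n p b) / alt_norm n p (\<lambda>k. a k + b k)"
    by (simp add: alt_norm_nonneg)
  show "(alt_norm n p a + alt_norm n p b) / alt_norm n p (\<lambda>k. a k + b k) \<le> 2 powr (1 - 1 / p)"
    using alt_norm_add_ge[OF *(1-3)] alt_norm_nonneg[of n p "\<lambda>k. a k + b k"] *(4)
    by (simp add: divide_le_eq)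
next
  fix n :: enat and C
  assume p: "1 \<le> p" and n: "3 \<le> n"
    and C: "\<forall>a b. admissible n p a \<longrightarrow> admissible n p b \<longrightarrow>
      alt_norm n p (\<lambda>k. a k + b k) \<noteq> 0 \<longrightarrow>
      (alt_norm n p a + alt_norm n p b) / alt_norm n p (\<lambda>k. a k + b k) \<le> C"
  obtain a b where ab: "\<And>m::nat. admissible n p (a m)" "\<And>m. admissible n p (b m)"
    "\<And>m. alt_norm n p (a m) = 1" "\<And>m. alt_norm n p (b m) = 1"
    "\<And>m. alt_norm n p (\<lambda>k. a m k + b m k) > 0"
    "(\<lambda>m. alt_norm n p (\<lambda>k. a m k + b m k)) \<longlonglongrightarrow> 2 powr (1 / p)"
    using extremal_family[of p n] p n by auto
  \<comment> \<open>Both norms in the numerator are 1, so along the extremal family the fraction is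
    2 over the norm of the sum.\<close>
  have "(\<lambda>m. 2 / alt_norm n p (\<lambda>k. a m k + b m k)) \<longlonglongrightarrow> 2 / 2 powr (1 / p)"
    by (intro tendsto_intros ab) auto
  moreover have "2 / alt_norm n p (\<lambda>k. a m k + b m k) \<le> C" for m
    using C[rule_format, of "a m" "b m"] ab(1-4)[of m] ab(5)[of m] by simp
  ultimately have "2 / 2 powr (1 / p) \<le> C"
    by (intro LIMSEQ_le_const2) auto
  then show "2 powr (1 - 1 / p) \<le> C" by (simp add: powr_diff)
next
  fix n :: enat and c :: real
  assume p: "1 < p" and n: "2 \<le> n" and c: "0 < c"
    and C: "\<forall>a b. admissible n p a \<longrightarrow> admissible n p b \<longrightarrow>
      alt_norm n p (\<lambda>k. a k + b k) \<noteq> 0 \<longrightarrow>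
      c \<le> (alt_norm n p a + alt_norm n p b) / alt_norm n p (\<lambda>k. a k + b k)"
  obtain e where e: "0 < e" "e powr (1 - 1 / p) < c"
    using small_powr_exists[of c "1 - 1 / p"] c p by auto
  obtain a b where ab: "admissible n p a" "admissible n p b"
    "alt_norm n p a = 0" "alt_norm n p b = e"
    "alt_norm n p (\<lambda>k. a k + b k) = ((1 + e) powr p - 1) powr (1 / p)"
    using degenerate_family[of p n e] p n e by auto
  \<comment> \<open>This elementary bound makes the denominator at least e^(1/p), so the fraction is
    at most e^(1-1/p), which was chosen below \<open>c\<close>.\<close>
  have "(1 + e) powr 1 \<le> (1 + e) powr p"
    using p e by (intro powr_mono) auto
  then have le: "e \<le> (1 + e) powr p - 1" using e by simp
  then have S: "e powr (1 / p) \<le> ((1 + e) powr p - 1) powr (1 / p)"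
    using p e by (intro powr_mono2) auto
  \<comment> \<open>Together with \<open>S\<close> this shows that the denominator is nonzero, so
    the assumed lower bound applies to the pair.\<close>
  have pos: "0 < e powr (1 / p)" using e by simp
  have "c \<le> e / ((1 + e) powr p - 1) powr (1 / p)"
    using C[rule_format, of a b] ab less_le_trans[OF pos S] by simp
  also have "\<dots> \<le> e / e powr (1 / p)"
    using S e less_le_trans[OF pos S] by (intro divide_left_mono mult_pos_pos pos) auto
  also have "\<dots> = e powr (1 - 1 / p)"
    using e by (simp add: powr_diff)
  finally show False using e by simp
next
  fix n :: enat and a b
  assume *: "0 < p" "p < 1" "admissible n p a" "admissible n p b"
    "alt_norm n p a + alt_norm n p b \<noteq> 0"
  show "0 \<le> alt_norm n p (\<lambda>k. a k + b k) / (alt_norm n p a + alt_norm n p b)"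
    by (simp add: alt_norm_nonneg)
  have "0 < alt_norm n p a + alt_norm n p b"
    using *(5) alt_norm_nonneg[of n p a] alt_norm_nonneg[of n p b] by simp
  then show "alt_norm n p (\<lambda>k. a k + b k) / (alt_norm n p a + alt_norm n p b) \<le> 2 powr (1 / p - 1)"
    using alt_norm_add_le[of p n a b] * by (simp add: divide_le_eq)
next
  fix n :: enat and C
  assume p: "0 < p" "p < 1" and n: "3 \<le> n"
    and C: "\<forall>a b. admissible n p a \<longrightarrow> admissible n p b \<longrightarrow>
      alt_norm n p a + alt_norm n p b \<noteq> 0 \<longrightarrow>
      alt_norm n p (\<lambda>k. a k + b k) / (alt_norm n p a + alt_norm n p b) \<le> C"
  obtain a b where ab: "\<And>m::nat. admissible n p (a m)" "\<And>m. admissible n p (b m)"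
    "\<And>m. alt_norm n p (a m) = 1" "\<And>m. alt_norm n p (b m) = 1"
    "\<And>m. alt_norm n p (\<lambda>k. a m k + b m k) > 0"
    "(\<lambda>m. alt_norm n p (\<lambda>k. a m k + b m k)) \<longlonglongrightarrow> 2 powr (1 / p)"
    using extremal_family[of p n] p n by auto
  \<comment> \<open>The same family serves the reciprocal fraction, whose denominator is now the
    constant 1 + 1.\<close>
  have "(\<lambda>m. alt_norm n p (\<lambda>k. a m k + b m k) / 2) \<longlonglongrightarrow> 2 powr (1 / p) / 2"
    by (intro tendsto_intros ab) auto
  moreover have "alt_norm n p (\<lambda>k. a m k + b m k) / 2 \<le> C" for m
    using C[rule_format, of "a m" "b m"] ab(1-4)[of m] by simp
  ultimately have "2 powr (1 / p) / 2 \<le> C"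
    by (intro LIMSEQ_le_const2) auto
  then show "2 powr (1 / p - 1) \<le> C" by (simp add: powr_diff)
next
  fix n :: enat and c :: real
  assume p: "0 < p" "p < 1" and n: "2 \<le> n" and c: "0 < c"
    and C: "\<forall>a b. admissible n p a \<longrightarrow> admissible n p b \<longrightarrow>
      alt_norm n p a + alt_norm n p b \<noteq> 0 \<longrightarrow>
      c \<le> alt_norm n p (\<lambda>k. a k + b k) / (alt_norm n p a + alt_norm n p b)"
  obtain e where e: "0 < e" "e powr (1 / p - 1) < c"
    using small_powr_exists[of c "1 / p - 1"] c p by auto
  obtain a b where ab: "admissible n p a" "admissible n p b"
    "alt_norm n p a = 0" "alt_norm n p b = e"
    "alt_norm n p (\<lambda>k. a k + b k) = ((1 + e) powr p - 1) powr (1 / p)"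
    using degenerate_family[of p n e] p n e by auto
  \<comment> \<open>The first bound gives (1 + e)^p - 1 <= e, reversing the case p > 1; the second
    keeps this base non-negative, so that the 1/p-th power is monotone.\<close>
  have "(1 + e) powr p \<le> (1 + e) powr 1" "1 \<le> (1 + e) powr p"
    using p e by (intro powr_mono ge_one_powr_ge_zero; simp)+
  then have S: "((1 + e) powr p - 1) powr (1 / p) \<le> e powr (1 / p)"
    using p e by (intro powr_mono2) auto
  have "c \<le> ((1 + e) powr p - 1) powr (1 / p) / e"
    using C[rule_format, of a b] ab e by simp
  also have "\<dots> \<le> e powr (1 / p) / e"
    using S e by (intro divide_right_mono) auto
  also have "\<dots> = e powr (1 / p - 1)"
    using e by (simp add: powr_diff)
  finally show False using e by simp
qed

end
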